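(* Let $0<p<\infty$ and $\omega\in\widehat{\mathcal{D}}(\mathbb{D})$. If $G$ is a dominating set for $A^p_\omega$, then there exists a constant $\delta>0$ such that $$\omega(G\cap S)>\delta\,\omega(S)$$ for all Carleson squares $S$.
   Context: $\mathbb{D}=\{z\in\mathbb{C}:|z|<1\}$, $\mathcal{H}(\mathbb{D})$ is the space of analytic functions in $\mathbb{D}$, and $dA(z)=\frac{dx\,dy}{\pi}$. A weight is a function $\omega:\mathbb{D}\to[0,\infty)$ integrable over $\mathbb{D}$ (with respect to $dA$), not necessarily radial; for measurable $E\subset\mathbb{D}$, $\omega(E)=\int_E\omega\,dA$. $A^p_\omega$ consists of $f\in\mathcal{H}(\mathbb{D})$ with $\|f\|_{A^p_\omega}^p=\int_{\mathbb{D}}|f|^p\omega\,dA<\infty$. Carleson squares are the sets $S(a)=\{re^{i\theta}\in\mathbb{D}:|a|<r<1,\ |\arg(ae^{-i\theta})|<\frac{1-|a|}{2}\}$, $a\in\mathbb{D}\setminus\{0\}$. A weight $\omega$ belongs to $\widehat{\mathcal{D}}(\mathbb{D})$ if there exists $C=C(\omega)>0$ such that $\omega(S(a))\le C\,\omega\left(S\left(\frac{1+|a|}{2}e^{i\arg a}\right)\right)$ for all $a\in\mathbb{D}\setminus\{0\}$. A measurable set $G\subset\mathbb{D}$ is a dominating set for $A^p_\omega$ if there exists $\delta=\delta(G)>0$ such that $\int_G|f|^p\omega\,dA\ge\delta\|f\|_{A^p_\omega}^p$ for all $f\in A^p_\omega$.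
   Formalization: The weight is assumed nontrivial, ω(𝔻) > 0; for ω = 0 almost everywhere every measurable G is dominating but the strict inequality reads 0 > 0, so the claim fails exactly there. *)

theory Defs
  imports "HOL-Analysis.Analysis"
begin

abbreviation unit_disc :: "complex set" where
  "unit_disc \<equiv> ball 0 1"

text \<open>Normalised area measure \<open>dx dy / \<pi>\<close>; its measurable sets are the Lebesgue measurable sets.\<close>
definition area_measure :: "complex measure" where
  "area_measure = density lebesgue (\<lambda>_. ennreal (1 / pi))"

text \<open>Weights live on the unit disc; the values of \<open>\<omega>\<close> outside the disc are irrelevant.\<close>
definition is_weight :: "(complex \<Rightarrow> real) \<Rightarrow> bool" where
  "is_weight \<omega> \<longleftrightarrow>
     (\<forall>z\<in>unit_disc. 0 \<le> \<omega> z) \<and> set_integrable area_measure unit_disc \<omega>"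

definition weight_of :: "(complex \<Rightarrow> real) \<Rightarrow> complex set \<Rightarrow> real" where
  "weight_of \<omega> E = (LINT z:E|area_measure. \<omega> z)"

definition bergman_space :: "real \<Rightarrow> (complex \<Rightarrow> real) \<Rightarrow> (complex \<Rightarrow> complex) set" where
  "bergman_space p \<omega> = {f. f holomorphic_on unit_disc \<and>
     set_integrable area_measure unit_disc (\<lambda>z. norm (f z) powr p * \<omega> z)}"

definition bergman_norm :: "real \<Rightarrow> (complex \<Rightarrow> real) \<Rightarrow> (complex \<Rightarrow> complex) \<Rightarrow> real" where
  "bergman_norm p \<omega> f =
     (LINT z:unit_disc|area_measure. norm (f z) powr p * \<omega> z) powr (1 / p)"

definition carleson_square :: "complex \<Rightarrow> complex set" where
  "carleson_square a = {z. \<exists>r \<theta>. z = of_real r * cis \<theta> \<and> norm a < r \<and> r < 1 \<and>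
     \<bar>Arg (a * cis (- \<theta>))\<bar> < (1 - norm a) / 2}"

definition D_hat :: "(complex \<Rightarrow> real) set" where
  "D_hat = {\<omega>. is_weight \<omega> \<and> (\<exists>C>0. \<forall>a\<in>unit_disc - {0}.
     weight_of \<omega> (carleson_square a)
       \<le> C * weight_of \<omega> (carleson_square (of_real ((1 + norm a) / 2) * cis (Arg a))))}"

definition dominating_set :: "real \<Rightarrow> (complex \<Rightarrow> real) \<Rightarrow> complex set \<Rightarrow> bool" where
  "dominating_set p \<omega> G \<longleftrightarrow> G \<in> sets lebesgue \<and> G \<subseteq> unit_disc \<and>
     (\<exists>\<delta>>0. \<forall>f\<in>bergman_space p \<omega>.
        (LINT z:G|area_measure. norm (f z) powr p * \<omega> z) \<ge> \<delta> * bergman_norm p \<omega> f powr p)"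

end

theory Submission
  imports Defs
begin

text \<open>
  Write \<open>S(u, t)\<close> for the Carleson square in direction \<open>u\<close> with side \<open>t\<close>, and extend it by the whole
  disc for \<open>t \<ge> 1\<close>. A square of zero weight would, by doubling, make a whole sector null, and then
  the neighbouring sectors, hence the disc; so all squares have positive weight. Compactness of
  the circle bounds the weights of the squares with \<open>t = 1/2\<close> away from zero, so doubling
  also holds, uniformly, for the extended squares.

  Given \<open>S(u, t)\<close>, put \<open>h = t / 2^k\<close> and test the domination inequality on
  \<open>f z = (u - (1 - h) z)^(-N)\<close>. Then \<open>|f|^p \<ge> (3 h)^(-N p)\<close> on \<open>S(u, h)\<close> while
  \<open>|f|^p \<le> (2^j h / 8)^(-N p)\<close> off \<open>S(u, 2^j h)\<close>. Once \<open>N\<close> beats the doubling constant, the dyadic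
  sum over \<open>j \<ge> k\<close> shows that the integral of \<open>|f|^p\<close> outside \<open>S(u, t)\<close> is at most \<open>2^(-k)\<close>
  times a multiple of the whole integral. For large \<open>k\<close> the domination inequality therefore lives on
  \<open>G \<inter> S(u, t)\<close>, where \<open>|f|^p \<le> h^(-N p)\<close>.
\<close>

text \<open>The angular condition \<open>|arg| < t/2\<close> becomes a chordal one, which obeys a triangle inequality.\<close>
definition csq :: "complex \<Rightarrow> real \<Rightarrow> complex set" where
  "csq u t = {z. 1 - t < norm z \<and> norm z < 1 \<and> norm (sgn z - u) < 2 * sin (t / 4)}"

text \<open>Beyond side 1 the formula of \<open>csq\<close> would only give sectors, and not
  monotonically in \<open>t\<close>. With the whole disc instead, the family increases with
  \<open>t\<close> and exhausts the disc.\<close>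

definition esq :: "complex \<Rightarrow> real \<Rightarrow> complex set" where
  "esq u t = (if t < 1 then csq u t else unit_disc)"

section \<open>From arguments to chords\<close>

lemma norm_cis_diff_one: "norm (cis x - 1) = 2 * \<bar>sin (x / 2)\<bar>"
proof -
  have "cis x - 1 = 2 * \<i> * of_real (sin (x / 2)) * cis (x / 2)"
    using cos_double_sin[of "x/2"] sin_double[of "x/2"]
    by (simp add: complex_eq_iff power2_eq_square)
  thus ?thesis by (simp add: norm_mult)
qed

text \<open>Multiplication by the unimodular \<open>sgn z\<close> carries the chord from 1 to
  \<open>cis (Arg (a * cnj z))\<close> to the chord from \<open>sgn z\<close> to
  \<open>sgn a\<close>.\<close>

lemma norm_sgn_diff_eq_Arg:
  assumes "a \<noteq> 0" "z \<noteq> 0"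
  shows "norm (sgn z - sgn a) = 2 * \<bar>sin (Arg (a * cnj z) / 2)\<bar>"
proof -
  have "sgn (a * cnj z) = cis (Arg (a * cnj z))"
    using cis_Arg[of "a * cnj z"] assms by simp
  hence eq: "cis (Arg (a * cnj z)) = sgn a * cnj (sgn z)"
    by (simp add: sgn_mult) (simp add: sgn_eq)
  have "norm (sgn z - sgn a) = norm (sgn z) * norm (cis (Arg (a * cnj z)) - 1)"
  proof -
    have "sgn z * (cis (Arg (a * cnj z)) - 1) = sgn a - sgn z"
      unfolding eq using assms complex_norm_square[of "sgn z"]
      by (simp add: algebra_simps norm_sgn)
    thus ?thesis by (metis norm_minus_commute norm_mult)
  qed
  also have "\<dots> = 2 * \<bar>sin (Arg (a * cnj z) / 2)\<bar>"
    using assms by (simp add: norm_cis_diff_one norm_sgn)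
  finally show ?thesis .
qed

text \<open>Halving brings a principal argument into [-pi/2, pi/2], where sine is monotone; without
  it, arguments near pi would have small sine too.\<close>

lemma abs_less_iff_sin_half:
  assumes "- pi < x" "x \<le> pi" "0 < s" "s < 1"
  shows "\<bar>x\<bar> < s \<longleftrightarrow> \<bar>sin (x / 2)\<bar> < sin (s / 2)"
proof -
  have "\<bar>sin (x / 2)\<bar> = sin (\<bar>x\<bar> / 2)"
  proof -
    have "0 \<le> sin (\<bar>x\<bar> / 2)" using assms by (intro sin_ge_zero) auto
    thus ?thesis by (cases "x \<ge> 0") auto
  qed
  moreover have "sin (\<bar>x\<bar> / 2) < sin (s / 2) \<longleftrightarrow> \<bar>x\<bar> / 2 < s / 2"
    using assms pi_gt3 by (intro sin_mono_less_eq) auto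
  ultimately show ?thesis by auto
qed

lemma carleson_square_eq_csq:
  assumes "a \<noteq> 0" "norm a < 1"
  shows "carleson_square a = csq (sgn a) (1 - norm a)"
proof -
  have *: "\<bar>Arg (a * cnj z)\<bar> < (1 - norm a) / 2 \<longleftrightarrow>
      norm (sgn z - sgn a) < 2 * sin ((1 - norm a) / 4)" if "z \<noteq> 0" for z
  proof -
    have "0 < (1 - norm a) / 2" using assms by simp
    moreover have "- 1 < norm a" by (rule less_le_trans[OF _ norm_ge_zero]) simp
    hence "(1 - norm a) / 2 < 1" by (simp add: field_simps)
    ultimately show ?thesis
      using abs_less_iff_sin_half[of "Arg (a * cnj z)" "(1 - norm a) / 2"] assms that
        Arg_bounded[of "a * cnj z"] by (simp add: norm_sgn_diff_eq_Arg)
  qed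
  \<comment> \<open>A positive factor does not change \<open>Arg\<close>, so the angular condition
    depends on the point alone and not on its polar representation.\<close>
  have arg: "Arg (a * cis (- \<theta>)) = Arg (a * cnj (of_real r * cis \<theta>))" if "r > 0" for r \<theta>
  proof -
    have "a * cnj (of_real r * cis \<theta>) = of_real r * (a * cis (- \<theta>))"
      by (simp add: cis_cnj)
    thus ?thesis using that by (simp only: Arg_times_of_real)
  qed
  show ?thesis
  proof (intro equalityI subsetI)
    fix z assume "z \<in> carleson_square a"
    then obtain r \<theta> where z: "z = of_real r * cis \<theta>" "norm a < r" "r < 1"
      and A: "\<bar>Arg (a * cis (- \<theta>))\<bar> < (1 - norm a) / 2"
      unfolding carleson_square_def by blast
    have r: "r > 0" using z(2) norm_ge_zero[of a] by linarith
    have "norm z = r" using z r by (simp add: norm_mult)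
    moreover have "z \<noteq> 0" using z r by auto
    ultimately show "z \<in> csq (sgn a) (1 - norm a)"
      using *[of z] A z arg[OF r, of \<theta>] by (simp add: csq_def)
  next
    fix z assume z: "z \<in> csq (sgn a) (1 - norm a)"
    hence r: "norm z > 0" using assms(1) by (auto simp: csq_def)
    have eq: "z = of_real (norm z) * cis (Arg z)"
      using rcis_cmod_Arg[of z] by (simp add: rcis_def)
    hence "\<bar>Arg (a * cis (- Arg z))\<bar> < (1 - norm a) / 2"
      using arg[OF r, of "Arg z"] *[of z] z r by (auto simp: csq_def)
    thus "z \<in> carleson_square a"
      using eq z unfolding carleson_square_def csq_def by auto
  qed
qed

lemma csq_measurable [measurable]: "csq u t \<in> sets borel"
  unfolding csq_def sgn_div_norm by measurable

lemma esq_measurable [measurable]: "esq u t \<in> sets borel"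
  by (simp add: esq_def)

lemma csq_subset_disc: "csq u t \<subseteq> unit_disc"
  by (auto simp: csq_def)

lemma esq_subset_disc: "esq u t \<subseteq> unit_disc"
  using csq_subset_disc by (auto simp: esq_def)

lemma csq_subset_csq:
  assumes "s \<le> t" "norm (u - v) \<le> 2 * sin (t / 4) - 2 * sin (s / 4)"
  shows "csq v s \<subseteq> csq u t"
proof
  fix z assume z: "z \<in> csq v s"
  have "norm (sgn z - u) \<le> norm (sgn z - v) + norm (u - v)"
    using dist_triangle[of "sgn z" u v] by (simp add: dist_norm norm_minus_commute)
  thus "z \<in> csq u t" using z assms by (auto simp: csq_def)
qed

lemma csq_mono:
  assumes "0 \<le> s" "s \<le> t" "t \<le> 1"
  shows "csq u s \<subseteq> csq u t"
  using assms pi_gt3 by (intro csq_subset_csq) (auto intro!: sin_monotone_2pi_le)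

lemma esq_mono:
  assumes "0 \<le> s" "s \<le> t"
  shows "esq u s \<subseteq> esq u t"
  using assms csq_mono[of s t u] csq_subset_disc by (auto simp: esq_def)

section \<open>Size of the denominator of the test function\<close>

lemma sin_ge_half:
  fixes x :: real assumes "0 \<le> x" "x \<le> 1" shows "x / 2 \<le> sin x"
proof -
  have "\<bar>sin x - x\<bar> \<le> \<bar>x\<bar> ^ 3 / 6"
    using Maclaurin_sin_bound[of x 3] by (simp add: eval_nat_numeral sin_coeff_def field_simps)
  moreover have "x ^ 3 \<le> x * 1" unfolding power3_eq_cube mult.assoc
    using assms by (intro mult_left_mono mult_le_one) auto
  ultimately show ?thesis using assms by (auto simp: abs_if split: if_splits)
qed

text \<open>With \<open>w = (1 - h) z\<close>, either \<open>z\<close> is radially far, and 1 - |w|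
  is at least \<open>t\<close>, or its direction is far from \<open>u\<close>. In the second case
  the chord is at most |u - w| + (1 - |w|), hence at most 2 |u - w|, and sin (t/4) >= t/8 gives the
  constant.\<close>

lemma le_norm_outside_esq:
  assumes "norm u = 1" "0 < h" "h < 1" "h \<le> t" "norm z < 1" "z \<notin> esq u t"
  shows "t / 8 \<le> norm (u - of_real (1 - h) * z)"
proof -
  define w where "w = of_real (1 - h) * z"
  have t: "t < 1" and nin: "z \<notin> csq u t" using assms by (auto simp: esq_def split: if_splits)
  have nw: "norm w = (1 - h) * norm z" using assms by (simp add: w_def norm_mult del: of_real_diff)
  have nwz: "norm w \<le> norm z" unfolding nw using assms by (simp add: mult_left_le_one_le)
  have low: "1 - norm w \<le> norm (u - w)" using norm_triangle_ineq2[of u w] assms by simp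
  show ?thesis
  proof (cases "norm z \<le> 1 - t")
    case True
    then show ?thesis using low nwz assms unfolding w_def[symmetric] by linarith
  next
    case False
    hence z0: "z \<noteq> 0" using t by auto
    have "2 * sin (t / 4) \<le> norm (sgn z - u)" using nin False assms by (auto simp: csq_def)
    also have "\<dots> \<le> norm (u - w) + norm (w - sgn z)"
      using dist_triangle[of "sgn z" u w] by (simp add: dist_norm norm_minus_commute add.commute)
    also have "norm (w - sgn z) = 1 - norm w"
    proof -
      have "w - sgn z = of_real (norm w - 1) * sgn z"
        unfolding nw unfolding w_def using z0 by (simp add: sgn_eq field_simps)
      hence "norm (w - sgn z) = \<bar>norm w - 1\<bar>" using z0 by (simp only: norm_mult norm_of_real norm_sgn) simp
      thus ?thesis using nwz assms by simp
    qed
    finally have "2 * sin (t / 4) \<le> 2 * norm (u - w)" using low by simp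
    thus ?thesis using sin_ge_half[of "t / 4"] t assms unfolding w_def[symmetric] by simp
  qed
qed

text \<open>Three errors add up: the angular one is at most h/2, the radial one at most
  \<open>h\<close>, and the contraction by 1 - h moves \<open>z\<close> by at most
  \<open>h\<close>.\<close>

lemma norm_le_on_csq:
  assumes "norm u = 1" "0 < h" "h < 1" "z \<in> csq u h"
  shows "norm (u - of_real (1 - h) * z) \<le> 3 * h"
proof -
  have z: "1 - h < norm z" "norm z < 1" "norm (sgn z - u) < 2 * sin (h / 4)"
    using assms by (auto simp: csq_def)
  hence z0: "z \<noteq> 0" using assms by auto
  have "u - of_real (1 - h) * z = (u - sgn z) + ((sgn z - z) + of_real h * z)"
    by (simp add: algebra_simps)
  hence "norm (u - of_real (1 - h) * z) \<le> norm (u - sgn z) + (norm (sgn z - z) + norm (of_real h * z))"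
    using norm_triangle_mono[OF order_refl norm_triangle_ineq] by (simp only:)
  moreover have "norm (sgn z - z) = 1 - norm z"
  proof -
    have "sgn z - z = of_real (1 - norm z) * sgn z"
      using z0 by (simp add: sgn_eq field_simps)
    hence "norm (sgn z - z) = \<bar>1 - norm z\<bar>" using z0 by (simp only: norm_mult norm_of_real norm_sgn) simp
    thus ?thesis using z by simp
  qed
  moreover have "norm (of_real h * z) \<le> h" using assms z by (simp add: norm_mult mult_left_le)
  moreover have "2 * sin (h / 4) \<le> h / 2" using sin_x_le_x[of "h/4"] assms by simp
  ultimately show ?thesis using z assms by (simp add: norm_minus_commute)
qed

lemma le_norm_disc:
  fixes u z :: complex
  assumes "norm u = 1" "0 < h" "h < 1" "norm z < 1"
  shows "h \<le> norm (u - of_real (1 - h) * z)"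
proof -
  have "norm (of_real (1 - h) * z) \<le> 1 - h" using assms by (simp add: norm_mult mult_left_le del: of_real_diff)
  thus ?thesis using norm_triangle_ineq2[of u "of_real (1 - h) * z"] assms by simp
qed

lemma sphere_net:
  assumes "0 < e"
  obtains K :: "complex set" where "finite K" "K \<subseteq> sphere 0 1" "\<And>u. norm u = 1 \<Longrightarrow> \<exists>k\<in>K. norm (u - k) < e"
proof -
  have "compact (sphere (0::complex) 1)" by simp
  moreover have "sphere 0 1 \<subseteq> (\<Union>k\<in>sphere (0::complex) 1. ball k e)"
    using assms by (intro subsetI UN_I) auto
  ultimately obtain K where K: "K \<subseteq> sphere (0::complex) 1" "finite K"
      and cover: "sphere 0 1 \<subseteq> (\<Union>k\<in>K. ball k e)"
    using compactE_image[of "sphere 0 1" "sphere 0 1" "\<lambda>k. ball k e"] open_ball by metis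
  have "\<exists>k\<in>K. norm (u - k) < e" if "norm u = 1" for u
  proof -
    have "u \<in> sphere 0 1" using that by simp
    then obtain k where "k \<in> K" "u \<in> ball k e" using cover by blast
    thus ?thesis by (auto simp: dist_norm norm_minus_commute)
  qed
  with K(2,1) show ?thesis by (rule that)
qed

section \<open>Doubling measures on the disc: all squares are charged\<close>

text \<open>The measure models the weight times area. The origin gets its own assumption because no
  square of side below 1 contains it, so squares can cover only the punctured disc.\<close>

locale disc_doubling = finite_measure \<nu> for \<nu> :: "complex measure" +
  fixes C :: real
  assumes sets_nu: "sets \<nu> = sets lebesgue"
    and pos_disc: "0 < measure \<nu> unit_disc"
    and zero_null: "emeasure \<nu> {0} = 0"
    and C_pos: "0 < C"
    and csq_doubling: "\<And>u t. norm u = 1 \<Longrightarrow> 0 < t \<Longrightarrow> t < 1 \<Longrightarrow>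
        measure \<nu> (csq u t) \<le> C * measure \<nu> (csq u (t / 2))"
begin

lemma borel_sets_nu [measurable (raw)]: "A \<in> sets borel \<Longrightarrow> A \<in> sets \<nu>"
  unfolding sets_nu by simp

lemma space_nu: "space \<nu> = UNIV"
  using sets_eq_imp_space_eq[OF sets_nu] by simp

lemma borel_measurable_nu:
  assumes "f \<in> borel_measurable borel"
  shows "f \<in> borel_measurable \<nu>"
proof -
  have "f \<in> borel_measurable lborel" unfolding measurable_lborel2 by (rule assms)
  hence "f \<in> borel_measurable lebesgue" by (rule measurable_completion)
  thus ?thesis unfolding measurable_cong_sets[OF sets_nu refl] .
qed

lemma csq_doubling_iter:
  assumes "norm u = 1" "0 < t" "t < 1"
  shows "measure \<nu> (csq u t) \<le> C ^ n * measure \<nu> (csq u (t / 2 ^ n))"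
proof (induction n)
  case (Suc n)
  have "t / 2 ^ n < 1" using assms by (simp add: divide_less_eq less_le_trans[OF _ one_le_power])
  hence "measure \<nu> (csq u (t / 2 ^ n)) \<le> C * measure \<nu> (csq u (t / 2 ^ n / 2))"
    using assms by (intro csq_doubling) auto
  hence "C ^ n * measure \<nu> (csq u (t / 2 ^ n)) \<le> C ^ n * (C * measure \<nu> (csq u (t / 2 ^ n / 2)))"
    using C_pos by (intro mult_left_mono) auto
  also have "\<dots> = C ^ Suc n * measure \<nu> (csq u (t / 2 ^ Suc n))" by (simp add: ac_simps)
  finally show ?case using Suc by simp
qed auto

text \<open>Halving the side \<open>s\<close> often enough puts the square inside the null one;
  doubling then leads back up to \<open>s\<close>.\<close>

lemma csq_null_radial:
  assumes "norm u = 1" "0 < t" "t < 1" "0 < s" "s < 1" "measure \<nu> (csq u t) = 0"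
  shows "measure \<nu> (csq u s) = 0"
proof -
  obtain n where n: "s / 2 ^ n < t"
    using real_arch_pow[of 2 "s / t"] assms by (auto simp: field_simps)
  have "measure \<nu> (csq u (s / 2 ^ n)) \<le> measure \<nu> (csq u t)"
    using assms n by (intro finite_measure_mono csq_mono) auto
  hence "measure \<nu> (csq u (s / 2 ^ n)) = 0" using assms(6) measure_nonneg[of \<nu>] by (metis antisym)
  thus ?thesis using csq_doubling_iter[of u s n] assms measure_nonneg[of \<nu> "csq u s"] by simp
qed

text \<open>The difference of the chordal radii for sides 1/2 and 1/4: a direction may turn by this
  much while its quarter square stays in the old half square.\<close>

definition gap :: real where "gap = 2 * sin (1 / 8) - 2 * sin (1 / 16)"

lemma gap_pos: "0 < gap"
  unfolding gap_def using sin_monotone_2pi[of "1/16" "1/8"] pi_gt3 by simp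

lemma csq_quarter_subset_half: "norm (u - v) < gap \<Longrightarrow> csq v (1 / 4) \<subseteq> csq u (1 / 2)"
  by (rule csq_subset_csq) (auto simp: gap_def)

lemma csq_null_nearby:
  assumes "norm u = 1" "norm v = 1" "norm (u - v) < gap" "measure \<nu> (csq u (1 / 2)) = 0"
  shows "measure \<nu> (csq v (1 / 2)) = 0"
proof -
  have "measure \<nu> (csq v (1 / 4)) \<le> measure \<nu> (csq u (1 / 2))"
    using assms by (intro finite_measure_mono csq_quarter_subset_half) auto
  hence "measure \<nu> (csq v (1 / 4)) = 0" using assms(4) measure_nonneg[of \<nu>] by (metis antisym)
  thus ?thesis using csq_null_radial[of v "1/4" "1/2"] assms by simp
qed

text \<open>Nullness is locally constant in the direction, by \<open>csq_null_nearby\<close> used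
  both ways, and the circle is connected.\<close>

lemma csq_null_everywhere:
  assumes "norm u = 1" "norm v = 1" "measure \<nu> (csq u (1 / 2)) = 0"
  shows "measure \<nu> (csq v (1 / 2)) = 0"
proof -
  define Z where "Z = (\<lambda>u. measure \<nu> (csq u (1 / 2)) = 0)"
  have "Z u = Z v"
  proof (rule connected_equivalence_relation[of "sphere (0::complex) 1" u v "\<lambda>x y. Z x = Z y"])
    show "connected (sphere (0::complex) 1)" by (intro connected_sphere) simp
    show "u \<in> sphere 0 1" "v \<in> sphere 0 1" using assms by auto
    fix a :: complex assume a: "a \<in> sphere 0 1"
    have "Z a = Z x" if "x \<in> sphere 0 1 \<inter> ball a gap" for x
      using csq_null_nearby[of a x] csq_null_nearby[of x a] a that
      unfolding Z_def by (auto simp: dist_norm norm_minus_commute)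
    moreover have "openin (top_of_set (sphere 0 1)) (sphere 0 1 \<inter> ball a gap)"
      by (intro openin_open_Int open_ball)
    ultimately show "\<exists>T. openin (top_of_set (sphere 0 1)) T \<and> a \<in> T \<and> (\<forall>x\<in>T. Z a = Z x)"
      using a gap_pos by (intro exI[of _ "sphere 0 1 \<inter> ball a gap"]) simp
  qed (simp_all only:)
  thus ?thesis using assms by (simp add: Z_def)
qed

lemma csq_pos:
  assumes u: "norm u = 1" and t: "0 < t" "t < 1"
  shows "0 < measure \<nu> (csq u t)"
proof (rule ccontr)
  assume "\<not> ?thesis"
  hence "measure \<nu> (csq u t) = 0" using measure_nonneg[of \<nu> "csq u t"] by linarith
  hence "measure \<nu> (csq u (1/2)) = 0" using csq_null_radial[of u t "1/2"] assms by simp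
  hence null: "measure \<nu> (csq v s) = 0" if "norm v = 1" "0 < s" "s < 1" for v s
    using csq_null_everywhere[OF u that(1)] csq_null_radial[of v "1/2" s] that by simp
  \<comment> \<open>This is the chordal radius for side 1/2. Since every side \<open>T n\<close>
    below is at least 1/2, one finite net of directions serves all \<open>n\<close>, while
    \<open>T n\<close> tends to 1 and reaches every nonzero point.\<close>
  have sp: "0 < 2 * sin (1/8::real)" using sin_gt_zero[of "1/8"] pi_gt3 by simp
  obtain K where K: "finite K" "K \<subseteq> sphere (0::complex) 1"
    "\<And>u. norm u = 1 \<Longrightarrow> \<exists>k\<in>K. norm (u - k) < 2 * sin (1/8)"
    using sphere_net[OF sp] by metis
  define T where "T = (\<lambda>n. 1 - 1 / real (n + 2))"
  have T: "1/2 \<le> T n" "T n < 1" for n by (auto simp: T_def field_simps)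
  have "unit_disc \<subseteq> {0} \<union> (\<Union>k\<in>K. \<Union>n. csq k (T n))"
  proof
    fix z :: complex assume z: "z \<in> unit_disc"
    show "z \<in> {0} \<union> (\<Union>k\<in>K. \<Union>n. csq k (T n))"
    proof (cases "z = 0")
      case False
      then obtain k where k: "k \<in> K" "norm (sgn z - k) < 2 * sin (1/8)"
        using K(3)[of "sgn z"] by (auto simp: norm_sgn)
      obtain n where n: "inverse (real (Suc n)) < norm z"
        using reals_Archimedean[of "norm z"] False by auto
      have "1 / real (n + 2) \<le> inverse (real (Suc n))" by (simp add: field_simps)
      moreover have "sin (1/8) \<le> sin (T n / 4)"
        using T[of n] pi_gt3 by (intro sin_monotone_2pi_le) auto
      ultimately have "z \<in> csq k (T n)" using n k z by (auto simp: csq_def T_def)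
      thus ?thesis using k by blast
    qed simp
  qed
  moreover have "{0} \<union> (\<Union>k\<in>K. \<Union>n. csq k (T n)) \<in> null_sets \<nu>"
  proof (intro null_sets.Un null_sets_UN'[OF countable_finite[OF K(1)]] null_sets_UN)
    show "{0} \<in> null_sets \<nu>" using zero_null by (intro null_setsI borel_sets_nu) auto
    fix k n assume "k \<in> K"
    hence "measure \<nu> (csq k (T n)) = 0" using K(2) T[of n] by (intro null) auto
    thus "csq k (T n) \<in> null_sets \<nu>"
      by (intro null_setsI borel_sets_nu) (auto simp: emeasure_eq_measure)
  qed
  ultimately have "unit_disc \<in> null_sets \<nu>"
    using null_sets_subset borel_sets_nu by (metis borel_open open_ball)
  thus False using pos_disc by (simp add: null_sets_def measure_def)
qed

section \<open>Uniform doubling for the extended squares\<close>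

text \<open>No continuity in \<open>u\<close> is required: each half square contains one of finitely
  many quarter squares, all of positive measure.\<close>

lemma csq_half_bounded_below:
  obtains c where "0 < c" "\<And>u. norm u = 1 \<Longrightarrow> c \<le> measure \<nu> (csq u (1 / 2))"
proof -
  obtain K where K: "finite K" "K \<subseteq> sphere (0::complex) 1"
    "\<And>u. norm u = 1 \<Longrightarrow> \<exists>k\<in>K. norm (u - k) < gap"
    using sphere_net[OF gap_pos] by metis
  have ne: "K \<noteq> {}" using K(3)[of 1] by auto
  define c where "c = Min ((\<lambda>k. measure \<nu> (csq k (1 / 4))) ` K)"
  have "0 < c" unfolding c_def using K ne by (subst Min_gr_iff) (auto intro!: csq_pos)
  moreover have "c \<le> measure \<nu> (csq u (1 / 2))" if u: "norm u = 1" for u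
  proof -
    obtain k where k: "k \<in> K" "norm (u - k) < gap" using K(3)[OF u] by auto
    have "c \<le> measure \<nu> (csq k (1 / 4))" unfolding c_def using K k by (intro Min_le) auto
    also have "\<dots> \<le> measure \<nu> (csq u (1 / 2))"
      using k by (intro finite_measure_mono csq_quarter_subset_half) auto
    finally show ?thesis .
  qed
  ultimately show ?thesis using that by blast
qed

lemma esq_doubling:
  obtains B where "1 \<le> B"
    "\<And>u t. norm u = 1 \<Longrightarrow> 0 < t \<Longrightarrow> measure \<nu> (esq u t) \<le> B * measure \<nu> (esq u (t / 2))"
proof -
  obtain c where c: "0 < c" "\<And>u. norm u = 1 \<Longrightarrow> c \<le> measure \<nu> (csq u (1 / 2))"
    using csq_half_bounded_below by blast
  define W where "W = measure \<nu> unit_disc"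
  \<comment> \<open>\<open>C\<close> handles sides below 1. For larger sides the left square is the
    disc, of measure \<open>W\<close>, and the right one contains a half square, of measure at least
    \<open>c\<close>.\<close>
  define B where "B = max 1 (max C (W / c))"
  have W: "0 < W" using pos_disc by (simp add: W_def)
  have "measure \<nu> (esq u t) \<le> B * measure \<nu> (esq u (t / 2))" if u: "norm u = 1" "0 < t" for u t
  proof (cases "t < 1")
    case True
    have "measure \<nu> (csq u t) \<le> C * measure \<nu> (csq u (t / 2))" using csq_doubling True u by blast
    also have "\<dots> \<le> B * measure \<nu> (csq u (t / 2))" by (intro mult_right_mono) (auto simp: B_def)
    finally show ?thesis using True u by (simp add: esq_def)
  next
    case False
    have "measure \<nu> (csq u (1 / 2)) \<le> measure \<nu> (esq u (t / 2))"
      using esq_mono[of "1/2" "t/2" u] False by (intro finite_measure_mono) (auto simp: esq_def)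
    hence "c \<le> measure \<nu> (esq u (t / 2))" using c(2)[OF u(1)] by linarith
    hence "W / c * c \<le> B * measure \<nu> (esq u (t / 2))"
      using W c by (intro mult_mono) (auto simp: B_def)
    thus ?thesis using c False by (simp add: esq_def W_def)
  qed
  thus ?thesis using that[of B] by (simp add: B_def)
qed

lemma esq_iter:
  assumes B: "1 \<le> B" "\<And>u t. norm u = 1 \<Longrightarrow> 0 < t \<Longrightarrow>
      measure \<nu> (esq u t) \<le> B * measure \<nu> (esq u (t / 2))"
    and u: "norm u = 1" and h: "0 < h" "h < 1"
  shows "measure \<nu> (esq u (2 ^ j * h)) \<le> B ^ j * measure \<nu> (csq u h)"
proof (induction j)
  case (Suc j)
  have "measure \<nu> (esq u (2 ^ Suc j * h)) \<le> B * measure \<nu> (esq u (2 ^ j * h))"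
    using B(2)[of u "2 ^ Suc j * h"] u h by simp
  also have "\<dots> \<le> B * (B ^ j * measure \<nu> (csq u h))"
    using Suc B by (intro mult_left_mono) auto
  finally show ?case by (simp add: ac_simps)
qed (use h in \<open>simp add: esq_def\<close>)

section \<open>Domination tested on a kernel with a pole near the square\<close>

text \<open>From one dyadic shell to the next the integrand bound falls by 2^(-q) and the measure
  bound grows by \<open>B\<close>; as 2 B <= 2^q, the shells are dominated by a geometric series of
  ratio 1/2.\<close>

lemma tail_integral_bound:
  assumes B: "1 \<le> B" "\<And>u t. norm u = 1 \<Longrightarrow> 0 < t \<Longrightarrow>
      measure \<nu> (esq u t) \<le> B * measure \<nu> (esq u (t / 2))"
    and u: "norm u = 1" and h: "0 < h" "h < 1" and q: "0 \<le> q" "2 * B \<le> 2 powr q"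
  shows "(LINT z:unit_disc - esq u (2 ^ k * h)|\<nu>. norm (u - of_real (1 - h) * z) powr (- q))
    \<le> (h / 8) powr (- q) * measure \<nu> (csq u h) * B * (2 * (1 / 2) ^ k)"
proof -
  define F where "F = (\<lambda>z. norm (u - of_real (1 - h) * z) powr (- q))"
  \<comment> \<open>The square of side \<open>2 ^ J * h\<close> is already the whole disc, so
    finitely many shells suffice.\<close>
  obtain J where J: "1 / h < 2 ^ J" using real_arch_pow[of 2 "1/h"] by auto
  have pointwise: "indicator (unit_disc - esq u (2 ^ k * h)) z * F z
      \<le> (\<Sum>j\<in>{k..<J}. (2 ^ j * h / 8) powr (- q) * indicator (esq u (2 ^ Suc j * h)) z)" for z
  proof (cases "z \<in> unit_disc - esq u (2 ^ k * h)")
    case True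
    have in_J: "z \<in> esq u (2 ^ J * h)"
      using J h True by (simp add: esq_def field_simps)
    \<comment> \<open>The first square containing \<open>z\<close> locates its shell:
      \<open>z\<close> lies in square \<open>m\<close> but not in square m - 1, so the single
      summand j = m - 1 already bounds the integrand.\<close>
    define m where "m = (LEAST j. z \<in> esq u (2 ^ j * h))"
    have m: "z \<in> esq u (2 ^ m * h)" unfolding m_def using in_J by (rule LeastI)
    have mJ: "m \<le> J" unfolding m_def using in_J by (rule Least_le)
    have km: "k < m"
    proof (rule ccontr)
      assume "\<not> k < m"
      hence "esq u (2 ^ m * h) \<subseteq> esq u (2 ^ k * h)"
        using h by (intro esq_mono mult_right_mono power_increasing) auto
      thus False using m True by auto
    qed
    define j where "j = m - 1"
    have j: "m = Suc j" "j \<in> {k..<J}" using km mJ by (auto simp: j_def)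
    have nin: "z \<notin> esq u (2 ^ j * h)"
      using not_less_Least[of j "\<lambda>j. z \<in> esq u (2 ^ j * h)"] j(1) by (simp add: m_def)
    have "2 ^ j * h / 8 \<le> norm (u - of_real (1 - h) * z)"
      using True u h nin by (intro le_norm_outside_esq) auto
    hence "F z \<le> (2 ^ j * h / 8) powr (- q)"
      unfolding F_def using q h by (intro powr_mono2') auto
    also have "\<dots> = (2 ^ j * h / 8) powr (- q) * indicator (esq u (2 ^ Suc j * h)) z"
      using m j by simp
    also have "\<dots> \<le> (\<Sum>j\<in>{k..<J}. (2 ^ j * h / 8) powr (- q) * indicator (esq u (2 ^ Suc j * h)) z)"
      by (rule member_le_sum[OF j(2)]) auto
    finally show ?thesis using True by simp
  qed (auto intro!: sum_nonneg)
  have int_ind: "integrable \<nu> (\<lambda>z. c * indicator (esq u t) z)" for c t :: real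
    by (intro integrable_mult_right integrable_real_indicator)
       (auto simp: emeasure_eq_measure)
  have "(LINT z:unit_disc - esq u (2 ^ k * h)|\<nu>. F z)
      \<le> (LINT z|\<nu>. (\<Sum>j\<in>{k..<J}. (2 ^ j * h / 8) powr (- q) * indicator (esq u (2 ^ Suc j * h)) z))"
    unfolding set_lebesgue_integral_def
    using pointwise by (intro integral_mono' Bochner_Integration.integrable_sum int_ind)
      (auto simp: F_def intro!: sum_nonneg)
  also have "\<dots> = (\<Sum>j\<in>{k..<J}. (2 ^ j * h / 8) powr (- q) * measure \<nu> (esq u (2 ^ Suc j * h)))"
    by (subst Bochner_Integration.integral_sum[OF int_ind]) (simp add: space_nu)
  also have "\<dots> \<le> (\<Sum>j\<in>{k..<J}. (h / 8) powr (- q) * measure \<nu> (csq u h) * B * (1 / 2) ^ j)"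
  proof (rule sum_mono)
    fix j
    have "(2 ^ j * h / 8) powr (- q) = (2 powr (- q)) ^ j * (h / 8) powr (- q)"
    proof -
      have "2 ^ j * h / 8 = 2 powr real j * (h / 8)" by (simp add: powr_realpow)
      moreover have "(2 powr (- q)) ^ j = (2 powr real j) powr (- q)"
        by (simp add: powr_powr mult.commute flip: powr_realpow)
      ultimately show ?thesis using h by (simp only: powr_mult)
    qed
    moreover have "(2 powr (- q)) ^ j * B ^ j \<le> (1 / 2) ^ j"
    proof -
      have "2 powr (- q) * B \<le> 1 / 2" using q by (simp add: powr_minus field_simps)
      thus ?thesis unfolding power_mult_distrib[symmetric] using B by (intro power_mono) auto
    qed
    ultimately have *: "(2 ^ j * h / 8) powr (- q) * B ^ j \<le> (h / 8) powr (- q) * (1 / 2) ^ j"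
      using mult_right_mono[of "(2 powr (- q)) ^ j * B ^ j" "(1 / 2) ^ j" "(h / 8) powr (- q)"]
      by (simp add: ac_simps)
    have "(2 ^ j * h / 8) powr (- q) * measure \<nu> (esq u (2 ^ Suc j * h))
      \<le> (2 ^ j * h / 8) powr (- q) * (B ^ Suc j * measure \<nu> (csq u h))"
      by (intro mult_left_mono esq_iter[OF B u h]) auto
    also have "\<dots> = ((2 ^ j * h / 8) powr (- q) * B ^ j) * (B * measure \<nu> (csq u h))" by simp
    also have "\<dots> \<le> ((h / 8) powr (- q) * (1 / 2) ^ j) * (B * measure \<nu> (csq u h))"
      using B by (intro mult_right_mono *) auto
    finally show "(2 ^ j * h / 8) powr (- q) * measure \<nu> (esq u (2 ^ Suc j * h))
      \<le> (h / 8) powr (- q) * measure \<nu> (csq u h) * B * (1 / 2) ^ j" by (simp add: ac_simps)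
  qed
  also have "\<dots> = (h / 8) powr (- q) * measure \<nu> (csq u h) * B * (\<Sum>j\<in>{k..<J}. (1 / 2) ^ j)"
    by (simp add: sum_distrib_left)
  also have "\<dots> \<le> (h / 8) powr (- q) * measure \<nu> (csq u h) * B * (2 * (1 / 2) ^ k)"
  proof (intro mult_left_mono)
    show "(\<Sum>j\<in>{k..<J}. (1 / 2 :: real) ^ j) \<le> 2 * (1 / 2) ^ k"
    proof (cases "k \<le> J")
      case True
      have "(\<Sum>j\<in>{k..<J}. (1 / 2 :: real) ^ j) = 2 * (1/2) ^ k - 2 * (1 / 2) ^ J"
        using True by (induction J rule: dec_induct) auto
      thus ?thesis by simp
    qed auto
  qed (use B in auto)
  finally show ?thesis by (simp add: F_def)
qed

lemma set_integrable_bounded: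
  fixes F :: "complex \<Rightarrow> real"
  assumes "E \<in> sets lebesgue" "F \<in> borel_measurable borel" "\<And>z. z \<in> E \<Longrightarrow> \<bar>F z\<bar> \<le> c"
  shows "set_integrable \<nu> E F"
proof -
  have E: "E \<in> sets \<nu>" unfolding sets_nu by (rule assms(1))
  have F: "F \<in> borel_measurable \<nu>" by (rule borel_measurable_nu[OF assms(2)])
  have meas: "(\<lambda>z. indicator E z *\<^sub>R F z) \<in> borel_measurable \<nu>"
    by (rule borel_measurable_scaleR[OF borel_measurable_indicator[OF E] F])
  have bound: "norm (indicator E z *\<^sub>R F z) \<le> \<bar>c\<bar>" for z
  proof (cases "z \<in> E")
    case True
    thus ?thesis using assms(3)[OF True] by simp
  qed simp
  show ?thesis
    unfolding set_integrable_def using bound by (intro integrable_const_bound[OF AE_I2 meas])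
qed

text \<open>Domination is assumed only for functions that are Borel on the whole plane, since
  members of the Bergman space are arbitrary off the disc; the test functions are of this
  kind.\<close>

lemma dominated_square_bound:
  assumes p: "0 < p" and G: "G \<in> sets lebesgue" "G \<subseteq> unit_disc" and \<delta>: "0 < \<delta>"
    and dom: "\<And>f. f holomorphic_on unit_disc \<Longrightarrow>
      set_integrable \<nu> unit_disc (\<lambda>z. norm (f z) powr p) \<Longrightarrow>
      f \<in> borel_measurable borel \<Longrightarrow>
      \<delta> * (LINT z:unit_disc|\<nu>. norm (f z) powr p) \<le> (LINT z:G|\<nu>. norm (f z) powr p)"
  obtains \<eta> where "0 < \<eta>" "\<And>u t. norm u = 1 \<Longrightarrow> 0 < t \<Longrightarrow> t < 1 \<Longrightarrow>
      \<eta> * measure \<nu> (csq u t) < measure \<nu> (G \<inter> csq u t)"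
proof -
  obtain B where B: "1 \<le> B" "\<And>u t. norm u = 1 \<Longrightarrow> 0 < t \<Longrightarrow>
      measure \<nu> (esq u t) \<le> B * measure \<nu> (esq u (t / 2))"
    by (rule esq_doubling) (rule that)
  \<comment> \<open>An integer exponent keeps the test function free of branches; its size gives the
    decay 2 B <= 2^q for q = N p.\<close>
  obtain N :: nat where N: "log 2 (2 * B) / p \<le> real N" "0 < N"
  proof -
    obtain n :: nat where "log 2 (2 * B) / p \<le> real n" using real_arch_simple by blast
    thus ?thesis using that[of "Suc n"] by simp
  qed
  define q where "q = real N * p"
  have q: "0 \<le> q" "2 * B \<le> 2 powr q"
  proof -
    have "log 2 (2 * B) \<le> q" using N p by (simp add: q_def pos_divide_le_eq)
    thus "2 * B \<le> 2 powr q" using B by (simp add: log_le_iff)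
  qed (use p in \<open>simp add: q_def\<close>)
  \<comment> \<open>Domination will give 2 c on the left, in units of \<open>H * M\<close>. The tail
    may use up one \<open>c\<close>, and the other remains for \<open>G\<close>.\<close>
  define c where "c = \<delta> * 3 powr (- q) / 2"
  have c: "0 < c" using \<delta> by (simp add: c_def)
  define A where "A = (1 / 8) powr (- q) * B * 2"
  have A: "0 < A" using B by (simp add: A_def)
  \<comment> \<open>\<open>A\<close> collects the constants of the tail bound, so \<open>k\<close>
    is chosen independently of \<open>u\<close> and \<open>t\<close>.\<close>
  obtain k where "(1 / 2) ^ k < c / A"
    using real_arch_pow_inv[of "c / A" "1 / 2"] c A by auto
  hence k: "A * (1 / 2) ^ k \<le> c" using A by (simp add: field_simps)
  \<comment> \<open>The factor \<open>B ^ k\<close> compares the square of side \<open>t\<close>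
    with that of side \<open>h\<close>; the extra 1/2 makes the final inequality strict.\<close>
  define \<eta> where "\<eta> = c / B ^ k / 2"
  have "\<eta> * measure \<nu> (csq u t) < measure \<nu> (G \<inter> csq u t)"
    if u: "norm u = 1" and t: "0 < t" "t < 1" for u t
  proof -
    define h where "h = t / 2 ^ k"
    have h: "0 < h" "h < 1" "2 ^ k * h = t"
      using t by (auto simp: h_def divide_less_eq intro: less_le_trans[OF _ one_le_power])
    define S where "S = csq u t"
    have S_eq: "esq u (2 ^ k * h) = S" using t h by (simp add: esq_def S_def)
    define M where "M = measure \<nu> (csq u h)"
    have M: "0 < M" unfolding M_def using u h by (intro csq_pos)
    define H where "H = h powr (- q)"
    have H: "0 < H" using h by (simp add: H_def)
    define f where "f = (\<lambda>z. 1 / (u - of_real (1 - h) * z) ^ N)"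
    define F where "F = (\<lambda>z. norm (u - of_real (1 - h) * z) powr (- q))"
    have nz: "u - of_real (1 - h) * z \<noteq> 0" if "norm z < 1" for z
      using le_norm_disc[OF u h(1,2) that] h by auto
    have F: "norm (f z) powr p = F z" for z
    proof -
      define d where "d = norm (u - of_real (1 - h) * z)"
      have "norm (f z) = 1 / d ^ N" by (simp add: f_def d_def norm_divide norm_power)
      moreover have "(1 / d ^ N) powr p = d powr (- q)"
      proof (cases "d = 0")
        case False
        hence "0 < d" by (simp add: d_def)
        hence "1 / d ^ N = d powr (- real N)" by (simp add: powr_minus powr_realpow divide_inverse)
        thus ?thesis by (simp add: powr_powr q_def)
      \<comment> \<open>At the pole, outside the disc, both sides are 0 by the conventions for
        division and \<open>powr\<close>, because 0 < N.\<close>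
      qed (use N(2) in simp)
      ultimately show ?thesis by (simp add: F_def d_def)
    qed
    have f_hol: "f holomorphic_on unit_disc"
      unfolding f_def using nz by (intro holomorphic_intros) auto
    have F_meas: "F \<in> borel_measurable borel" unfolding F_def by measurable
    have F_nonneg: "0 \<le> F z" for z by (simp add: F_def)
    have F_le: "F z \<le> H" if "norm z < 1" for z
      unfolding F_def H_def using le_norm_disc[OF u h(1,2) that] h q by (intro powr_mono2') auto
    have F_int: "set_integrable \<nu> E F" if "E \<in> sets lebesgue" "E \<subseteq> unit_disc" for E
    proof (rule set_integrable_bounded[OF that(1) F_meas])
      show "\<bar>F z\<bar> \<le> H" if "z \<in> E" for z
        using F_le[of z] F_nonneg[of z] that \<open>E \<subseteq> unit_disc\<close> by auto
    qed
    have int_ind: "integrable \<nu> (\<lambda>z. b * indicator E z)" if "E \<in> sets lebesgue" for b :: real and E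
      using that by (intro integrable_mult_right integrable_real_indicator)
       (auto simp: emeasure_eq_measure sets_nu)
    have S_sets: "S \<in> sets lebesgue" "S \<subseteq> unit_disc" "csq u h \<in> sets lebesgue"
      using csq_subset_disc by (auto simp: S_def)
    have D_sets: "unit_disc - S \<in> sets lebesgue" using S_sets by (intro sets.Diff) auto
    have "(3 * h) powr (- q) * M = (LINT z|\<nu>. (3 * h) powr (- q) * indicator (csq u h) z)"
      by (simp add: M_def space_nu)
    also have "\<dots> \<le> (LINT z:unit_disc|\<nu>. F z)"
      unfolding set_lebesgue_integral_def
    proof (intro integral_mono)
      show "integrable \<nu> (\<lambda>z. indicator unit_disc z *\<^sub>R F z)"
        using F_int[of unit_disc] by (simp add: set_integrable_def)
      show "(3 * h) powr (- q) * indicator (csq u h) z \<le> indicator unit_disc z *\<^sub>R F z" for z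
      proof (cases "z \<in> csq u h")
        case True
        moreover have "z \<in> unit_disc" using True csq_subset_disc by blast
        moreover have "(3 * h) powr (- q) \<le> F z"
          unfolding F_def using norm_le_on_csq[OF u h(1,2) True] nz \<open>z \<in> unit_disc\<close> q
          by (intro powr_mono2') auto
        ultimately show ?thesis by simp
      qed (use F_nonneg in auto)
    qed (use S_sets int_ind in auto)
    finally have lower: "3 powr (- q) * H * M \<le> (LINT z:unit_disc|\<nu>. F z)"
      using h by (simp add: powr_mult H_def)
    have "\<delta> * (LINT z:unit_disc|\<nu>. norm (f z) powr p) \<le> (LINT z:G|\<nu>. norm (f z) powr p)"
    proof (rule dom[OF f_hol])
      show "set_integrable \<nu> unit_disc (\<lambda>z. norm (f z) powr p)" unfolding F by (intro F_int) auto
      show "f \<in> borel_measurable borel" unfolding f_def by measurable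
    qed
    hence "\<delta> * (LINT z:unit_disc|\<nu>. F z) \<le> (LINT z:G|\<nu>. F z)" by (simp only: F)
    \<comment> \<open>\<open>G\<close> is split by \<open>S\<close>: inside, the integrand is at
      most \<open>H\<close>; outside, \<open>G\<close> is enlarged to the rest of the disc.\<close>
    also have "\<dots> \<le> (LINT z|\<nu>. H * indicator (G \<inter> S) z + indicator (unit_disc - S) z *\<^sub>R F z)"
      unfolding set_lebesgue_integral_def
    proof (intro integral_mono Bochner_Integration.integrable_add int_ind)
      show "integrable \<nu> (\<lambda>z. indicator G z *\<^sub>R F z)"
        using F_int[OF G] by (simp add: set_integrable_def)
      show "integrable \<nu> (\<lambda>z. indicator (unit_disc - S) z *\<^sub>R F z)"
        using F_int[OF D_sets] by (auto simp: set_integrable_def)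
      show "indicator G z *\<^sub>R F z \<le> H * indicator (G \<inter> S) z + indicator (unit_disc - S) z *\<^sub>R F z" for z
        using G F_le[of z] F_nonneg[of z] by (auto simp: indicator_def)
    qed (use G S_sets in auto)
    also have "\<dots> = H * measure \<nu> (G \<inter> S) + (LINT z:unit_disc - S|\<nu>. F z)"
      unfolding set_lebesgue_integral_def
      using F_int[OF D_sets] S_sets G
      by (subst Bochner_Integration.integral_add[OF int_ind]) (auto simp: set_integrable_def space_nu)
    also have "(LINT z:unit_disc - S|\<nu>. F z) \<le> (h / 8) powr (- q) * M * B * (2 * (1 / 2) ^ k)"
      using tail_integral_bound[OF B u h(1,2) q, of k] unfolding S_eq F_def M_def .
    also have "\<dots> = H * M * (A * (1 / 2) ^ k)"
      using h powr_mult[of "1/8" h "- q"] by (simp add: A_def H_def)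
    also have "\<dots> \<le> H * M * c" using k H M by (intro mult_left_mono) auto
    finally have upper: "\<delta> * (LINT z:unit_disc|\<nu>. F z) \<le> H * measure \<nu> (G \<inter> S) + H * M * c" by simp
    have "H * (2 * (c * M)) = \<delta> * (3 powr (- q) * H * M)" by (simp add: c_def)
    also have "\<dots> \<le> \<delta> * (LINT z:unit_disc|\<nu>. F z)"
      using lower \<delta> by (intro mult_left_mono) auto
    also note upper
    also have "H * measure \<nu> (G \<inter> S) + H * M * c = H * (measure \<nu> (G \<inter> S) + c * M)"
      by (simp add: algebra_simps)
    finally have *: "c * M \<le> measure \<nu> (G \<inter> S)" using H by (simp add: mult.commute)
    have "\<eta> * measure \<nu> S \<le> \<eta> * (B ^ k * M)"
      using esq_iter[OF B u h(1,2), of k] c B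
      by (intro mult_left_mono) (auto simp: S_eq M_def \<eta>_def)
    also have "\<dots> = c * M / 2" using B by (simp add: \<eta>_def)
    also have "\<dots> < c * M" using c M by simp
    finally show ?thesis using * by (simp add: S_def)
  qed
  moreover have "0 < \<eta>" using c B by (simp add: \<eta>_def)
  ultimately show ?thesis using that by blast
qed

end

section \<open>Transfer from weights to measures\<close>

text \<open>Positive total weight excludes the weight vanishing almost everywhere, for which the
  strict inequality would read 0 > 0.\<close>

theorem theorem9:
  fixes p :: real and \<omega> :: "complex \<Rightarrow> real" and G :: "complex set"
  assumes "0 < p"
    and "\<omega> \<in> D_hat"
    and nontrivial: "0 < weight_of \<omega> unit_disc"
    and "dominating_set p \<omega> G"
  shows "\<exists>\<delta>>0. \<forall>a\<in>unit_disc - {0}.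
    weight_of \<omega> (G \<inter> carleson_square a) > \<delta> * weight_of \<omega> (carleson_square a)"
proof -
  \<comment> \<open>The cutoff removes the arbitrary values off the disc, making the density
    nonnegative and integrable on the plane.\<close>
  define w where "w = (\<lambda>z. indicator unit_disc z * \<omega> z)"
  define \<nu> where "\<nu> = density area_measure (\<lambda>z. ennreal (w z))"
  obtain C where \<omega>: "\<forall>z\<in>unit_disc. 0 \<le> \<omega> z" "set_integrable area_measure unit_disc \<omega>"
    and C: "0 < C" "\<And>a. a \<in> unit_disc - {0} \<Longrightarrow> weight_of \<omega> (carleson_square a)
       \<le> C * weight_of \<omega> (carleson_square (of_real ((1 + norm a) / 2) * cis (Arg a)))"
    using assms(2) unfolding D_hat_def is_weight_def by blast
  have w_nonneg: "0 \<le> w z" for z using \<omega>(1) by (simp add: w_def indicator_def)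
  have w_int: "integrable area_measure w"
    using \<omega>(2) by (simp add: set_integrable_def w_def)
  hence w_meas: "w \<in> borel_measurable area_measure" by (rule borel_measurable_integrable)
  have sets_area: "sets area_measure = sets lebesgue" by (simp add: area_measure_def)
  have sets_nu: "sets \<nu> = sets lebesgue" by (simp add: \<nu>_def sets_area)
  have area_borel: "g \<in> borel_measurable area_measure" if "g \<in> borel_measurable borel"
    for g :: "complex \<Rightarrow> real"
    using measurable_completion[of g lborel borel] that
    by (subst measurable_cong_sets[OF sets_area refl]) simp
  have transfer_meas: "(\<lambda>z. indicator E z *\<^sub>R g z) \<in> borel_measurable area_measure"
    if "E \<in> sets lebesgue" "g \<in> borel_measurable borel" for E and g :: "complex \<Rightarrow> real"
    using that by (intro borel_measurable_scaleR borel_measurable_indicator area_borel)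
      (auto simp: sets_area)
  have transfer_eq: "w z * (indicator E z *\<^sub>R g z) = indicator E z *\<^sub>R (g z * \<omega> z)"
    if "E \<subseteq> unit_disc" for E z and g :: "complex \<Rightarrow> real"
    using that by (auto simp: w_def indicator_def)
  have transfer: "(LINT z:E|\<nu>. g z) = (LINT z:E|area_measure. g z * \<omega> z)"
    if "E \<in> sets lebesgue" "E \<subseteq> unit_disc" "g \<in> borel_measurable borel"
    for E and g :: "complex \<Rightarrow> real"
    unfolding set_lebesgue_integral_def \<nu>_def
    using integral_real_density[OF w_meas AE_I2 transfer_meas[OF that(1,3)]] w_nonneg
    by (simp only: transfer_eq[OF that(2)])
  have transfer_int: "set_integrable \<nu> E g \<longleftrightarrow> set_integrable area_measure E (\<lambda>z. g z * \<omega> z)"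
    if "E \<in> sets lebesgue" "E \<subseteq> unit_disc" "g \<in> borel_measurable borel"
    for E and g :: "complex \<Rightarrow> real"
    unfolding set_integrable_def \<nu>_def
    using integrable_real_density[OF w_meas AE_I2 transfer_meas[OF that(1,3)]] w_nonneg
    by (simp only: transfer_eq[OF that(2)])
  interpret nu: finite_measure \<nu>
  proof
    have "emeasure \<nu> (space \<nu>) = (\<integral>\<^sup>+z. ennreal (w z) \<partial>area_measure)"
      using w_meas unfolding \<nu>_def
      by (subst emeasure_density) (auto intro!: nn_integral_cong)
    also have "\<dots> < \<infinity>" using integrableD(2)[OF w_int] w_nonneg
      by (simp add: less_top)
    finally show "emeasure \<nu> (space \<nu>) \<noteq> \<infinity>" by simp
  qed
  have weight: "weight_of \<omega> E = measure \<nu> E" if "E \<in> sets lebesgue" "E \<subseteq> unit_disc" for E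
  proof -
    have "E \<inter> space \<nu> = E" using sets_eq_imp_space_eq[OF sets_nu] by simp
    thus ?thesis using transfer[OF that, of "\<lambda>_. 1"]
      by (simp add: weight_of_def set_lebesgue_integral_def)
  qed
  have weight_csq: "weight_of \<omega> (csq u t) = measure \<nu> (csq u t)" for u t
    using csq_subset_disc by (intro weight) auto
  interpret disc_doubling \<nu> C
  proof
    show "sets \<nu> = sets lebesgue" by (rule sets_nu)
    show "0 < measure \<nu> unit_disc" using nontrivial by (simp add: weight)
    show "0 < C" by (rule C)
    show "emeasure \<nu> {0} = 0"
    proof -
      have "AE z::complex in lebesgue. z \<notin> {0}"
        by (intro AE_not_in null_sets_completionI finite_imp_null_set_lborel) simp
      hence "AE z in area_measure. z \<notin> {0}"
        unfolding area_measure_def by (subst AE_density) auto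
      hence "AE z in \<nu>. z \<notin> {0}"
        unfolding \<nu>_def using w_meas by (subst AE_density) auto
      thus ?thesis
        using sets_eq_imp_space_eq[OF sets_nu] by (subst (asm) AE_iff_measurable) (auto simp: sets_nu)
    qed
    fix u :: complex and t :: real
    assume u: "norm u = 1" and t: "0 < t" "t < 1"
    \<comment> \<open>The square of \<open>a\<close> has direction \<open>u\<close> and side
      \<open>t\<close>; the point \<open>b\<close> below, from the condition in
      \<open>D_hat\<close>, has the same direction and side t/2.\<close>
    define a where "a = of_real (1 - t) * u"
    have a: "norm a = 1 - t" "a \<noteq> 0" "sgn a = u"
    proof -
      show n: "norm a = 1 - t" using u t by (simp add: a_def norm_mult del: of_real_diff)
      show "a \<noteq> 0" using n t by auto
      show "sgn a = u" unfolding sgn_eq n using t by (simp add: a_def)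
    qed
    define b where "b = of_real ((1 + norm a) / 2) * cis (Arg a)"
    have b: "norm b = 1 - t / 2" "b \<noteq> 0" "sgn b = u"
    proof -
      have b_eq: "b = of_real (1 - t / 2) * u"
      proof -
        have "(1 + norm a) / 2 = 1 - t / 2" unfolding a(1) by (simp add: field_simps)
        thus ?thesis unfolding b_def cis_Arg[OF a(2)] a(3) by (simp only:)
      qed
      show n: "norm b = 1 - t / 2" using u t by (simp add: b_eq norm_mult del: of_real_diff)
      show "b \<noteq> 0" using n t by auto
      have "1 - t / 2 \<noteq> 0" using t by simp
      hence "complex_of_real (1 - t / 2) \<noteq> 0" by (simp only: of_real_eq_0_iff not_False_eq_True)
      thus "sgn b = u" unfolding sgn_eq n unfolding b_eq by (rule nonzero_mult_div_cancel_left)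
    qed
    have "weight_of \<omega> (carleson_square a) \<le> C * weight_of \<omega> (carleson_square b)"
      unfolding b_def using a t by (intro C) auto
    thus "measure \<nu> (csq u t) \<le> C * measure \<nu> (csq u (t / 2))"
      using a b t by (simp add: carleson_square_eq_csq weight_csq)
  qed
  obtain \<delta> where G: "G \<in> sets lebesgue" "G \<subseteq> unit_disc" and \<delta>: "0 < \<delta>"
    and dom: "\<And>f. f \<in> bergman_space p \<omega> \<Longrightarrow>
        \<delta> * bergman_norm p \<omega> f powr p \<le> (LINT z:G|area_measure. norm (f z) powr p * \<omega> z)"
    using assms(4) unfolding dominating_set_def by blast
  obtain \<eta> where \<eta>: "0 < \<eta>" "\<And>u t. norm u = 1 \<Longrightarrow> 0 < t \<Longrightarrow> t < 1 \<Longrightarrow>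
      \<eta> * measure \<nu> (csq u t) < measure \<nu> (G \<inter> csq u t)"
  proof (rule dominated_square_bound[OF assms(1) G \<delta>])
    fix f :: "complex \<Rightarrow> complex"
    assume f: "f holomorphic_on unit_disc" "set_integrable \<nu> unit_disc (\<lambda>z. norm (f z) powr p)"
      "f \<in> borel_measurable borel"
    have meas: "(\<lambda>z. norm (f z) powr p) \<in> borel_measurable borel" using f(3) by measurable
    have "f \<in> bergman_space p \<omega>"
      using f meas by (simp add: bergman_space_def transfer_int)
    moreover have "bergman_norm p \<omega> f powr p = (LINT z:unit_disc|\<nu>. norm (f z) powr p)"
    proof -
      \<comment> \<open>Nonnegativity lets the powers 1/p and \<open>p\<close> cancel.\<close>
      have "0 \<le> (LINT z:unit_disc|\<nu>. norm (f z) powr p)"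
        unfolding set_lebesgue_integral_def by (intro integral_nonneg_AE AE_I2) simp
      thus ?thesis using assms(1) meas
        by (simp add: bergman_norm_def transfer powr_powr)
    qed
    ultimately show "\<delta> * (LINT z:unit_disc|\<nu>. norm (f z) powr p) \<le> (LINT z:G|\<nu>. norm (f z) powr p)"
      using dom[of f] G meas by (simp add: transfer)
  qed (rule that)
  show ?thesis
  proof (intro exI[of _ \<eta>] conjI ballI \<eta>(1))
    fix a :: complex assume a: "a \<in> unit_disc - {0}"
    have "G \<inter> csq u t \<in> sets lebesgue" "G \<inter> csq u t \<subseteq> unit_disc" for u t using G by auto
    thus "\<eta> * weight_of \<omega> (carleson_square a) < weight_of \<omega> (G \<inter> carleson_square a)"
      using \<eta>(2)[of "sgn a" "1 - norm a"] a
      by (simp add: carleson_square_eq_csq weight weight_csq norm_sgn)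
  qed
qed

end
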